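(* Let $P\subset\mathbb{R}^d$ be a lattice polytope and let $c\in\mathbb{Q}^d$. Then the $k$-th constituent of the Ehrhart quasi-polynomial $L_{c+P}(t)$ is $L_{(P,kc)}(t)$.
   Context: A lattice polytope (resp. rational polytope) is the convex hull of finitely many (at least one) points of $\mathbb{R}^d$ all of whose vertices lie in $\mathbb{Z}^d$ (resp. $\mathbb{Q}^d$). For a polytope $P\subset\mathbb{R}^d$ and $c\in\mathbb{R}^d$, the translated lattice point enumerator is $L_{(P,c)}(t)=\#((c+tP)\cap\mathbb{Z}^d)$, $t\in\mathbb{Z}_{>0}$; for $P$ a lattice polytope it is given by a polynomial in $t$ with rational coefficients, and it is identified with this polynomial. A quasi-polynomial is a function $L$ on the positive integers for which there are an integer $\rho>0$ (a period) and polynomials $f_1,\dots,f_\rho\in\mathbb{Q}[x]$ such that $L(t)=f_k(t)$ whenever $t\equiv k \pmod \rho$; $f_k$ is the $k$-th constituent, and $f_0:=f_\rho$. For a rational polytope $Q\subset\mathbb{R}^d$, the function $L_Q(t):=\#(tQ\cap\mathbb{Z}^d)$, $t\in\mathbb{Z}_{>0}$, is a quasi-polynomial, called the Ehrhart quasi-polynomial of $Q$. The Ehrhart quasi-polynomial $L_{c+P}$ has as a period $\operatorname{den}(c)$, the least common multiple of the denominators of the (reduced) coordinates of $c$. *)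

theory Defs
  imports
    "HOL-Analysis.Analysis"
    "HOL-Computational_Algebra.Polynomial"
    "HOL-Number_Theory.Cong"
begin

definition int_vectors :: "(real ^ 'n) set" where
  "int_vectors = {x. \<forall>i. x $ i \<in> \<int>}"

definition rat_vectors :: "(real ^ 'n) set" where
  "rat_vectors = {x. \<forall>i. x $ i \<in> \<rat>}"

definition lattice_polytope :: "(real ^ 'n) set \<Rightarrow> bool" where
  "lattice_polytope P \<longleftrightarrow>
     polytope P \<and> P \<noteq> {} \<and> (\<forall>v. v extreme_point_of P \<longrightarrow> v \<in> int_vectors)"

definition translated_enumerator :: "(real ^ 'n) set \<Rightarrow> real ^ 'n \<Rightarrow> nat \<Rightarrow> nat" where
  "translated_enumerator P c t =
     card ((\<lambda>x. c + x) ` ((\<lambda>x. real t *\<^sub>R x) ` P) \<inter> int_vectors)"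

definition ehrhart :: "(real ^ 'n) set \<Rightarrow> nat \<Rightarrow> nat" where
  "ehrhart Q t = card ((\<lambda>x. real t *\<^sub>R x) ` Q \<inter> int_vectors)"

text \<open>Functions on the positive integers are represented by functions on the naturals whose value
  at 0 is ignored. For a given period \<open>\<rho>\<close>, the polynomials \<open>f 1, \<dots>, f \<rho>\<close> are determined
  by \<open>L\<close>; the last conjunct is the convention on the constituent of index 0.\<close>

definition has_constituents :: "(nat \<Rightarrow> nat) \<Rightarrow> nat \<Rightarrow> (nat \<Rightarrow> rat poly) \<Rightarrow> bool" where
  "has_constituents L \<rho> f \<longleftrightarrow>
     \<rho> > 0 \<and>
     (\<forall>k\<in>{1..\<rho>}. \<forall>t>0. [t = k] (mod \<rho>) \<longrightarrow> poly (f k) (of_nat t) = of_nat (L t)) \<and>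
     f 0 = f \<rho>"

text \<open>Meaningful only for rational \<open>x\<close>: \<open>inv real_of_rat x\<close> is then \<open>x\<close> as an element of
  type \<open>rat\<close>, and \<open>quotient_of\<close> gives its reduced fraction with positive denominator.\<close>

definition denominator :: "real \<Rightarrow> nat" where
  "denominator x = nat (snd (quotient_of (inv real_of_rat x)))"

definition den :: "real ^ 'n \<Rightarrow> nat" where
  "den c = Lcm (range (\<lambda>i. denominator (c $ i)))"

end

theory Submission imports Defs begin

text \<open>
  Since \<open>t(c + P) = tc + tP\<close>, the value of the Ehrhart function of \<open>c + P\<close> at \<open>t\<close> is the number of
  lattice points of \<open>tc + tP\<close>, and integer translations preserve that number. As \<open>den c\<close> times
  \<open>c\<close> is integral, \<open>tc\<close> may be replaced by \<open>kc\<close> whenever \<open>t \<equiv> k\<close> modulo \<open>den c\<close>. So the Ehrhart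
  function agrees with the translated enumerator of \<open>(P, kc)\<close> on that residue class. Once the
  latter is known to be a polynomial in \<open>t\<close> (\<open>translated_enumerator_polynomial\<close>), it is the
  \<open>k\<close>-th constituent for the period \<open>den c\<close>; for an arbitrary period \<open>\<rho>\<close>, two polynomials are
  compared at the infinitely many \<open>t \<equiv> k\<close> modulo \<open>\<rho> den c\<close>.

  The substance is therefore Ehrhart's theorem for translated dilates: for \<open>P\<close> the convex hull of a
  finite set \<open>V\<close> of lattice points and any \<open>c\<close>, the enumerator \<open>L(t)\<close> is a polynomial. The proof
  uses no triangulation of \<open>P\<close>. It shows that the finite difference of order \<open>card V\<close> vanishes,
  that is, for all \<open>t \<ge> card V\<close>,
  \<open>(\<Sum>S\<subseteq>V. (-1)^|S| L(t - |S|)) = 0\<close>,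
  after which Newton's forward difference formula supplies the polynomial. Because the points of
  \<open>V\<close> are integral, \<open>L(t - |S|)\<close> counts the lattice points \<open>a\<close> with
  \<open>a - c - \<Sum>S \<in> (t - |S|)P\<close>, so it suffices to prove, for each fixed \<open>u\<close> in the role of
  \<open>a - c\<close>, that the sum of \<open>(-1)^|S|\<close> over all \<open>S\<close> with \<open>u - \<Sum>S \<in> (t - |S|)P\<close> is 0
  (\<open>alternating_sum_shifted_dilates\<close>).

  This is an Euler characteristic computation. Let \<open>W\<close> be the compact convex set of all families
  of weights \<open>w v \<ge> 0\<close> with total \<open>t\<close> and \<open>(\<Sum>v\<in>V. w v v) = u\<close>. The condition on \<open>S\<close> says that
  some \<open>w\<close> in \<open>W\<close> is at least 1 on \<open>S\<close>. As \<open>t \<ge> card V\<close>, every \<open>w\<close> is at least 1 somewhere, so the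
  sets \<open>{w \<in> W. w v \<ge> 1}\<close> cover \<open>W\<close>, and inclusion-exclusion gives a linear relation between the
  indicator functions of their intersections. A linear relation between indicator functions of
  compact convex sets remains true when the indicator of every nonempty set is replaced by 1 and
  that of the empty set by 0 (\<open>euler_relation\<close>), and this is the required identity.
\<close>

section \<open>An Euler relation for compact convex sets\<close>

text \<open>Just to the right of a point \<open>s\<close>, exactly the intervals with right endpoint \<open>s\<close> have been lost.
  So the weights of the intervals ending at \<open>s\<close> add up to the drop of a function that vanishes
  everywhere, and every nonempty interval has exactly one right endpoint.\<close>

lemma euler_relation_compact_intervals:
  fixes \<alpha> :: "'i \<Rightarrow> int" and A :: "'i \<Rightarrow> real set"
  assumes "finite J"
    and compact: "\<And>i. i \<in> J \<Longrightarrow> compact (A i)"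
    and connected: "\<And>i. i \<in> J \<Longrightarrow> connected (A i)"
    and zero: "\<And>s. sum \<alpha> {i \<in> J. s \<in> A i} = 0"
  shows "sum \<alpha> {i \<in> J. A i \<noteq> {}} = 0"
proof -
  have right_endpoints: "sum \<alpha> {i \<in> J. A i \<noteq> {} \<and> Sup (A i) = s} = 0" for s
  proof -
    have "\<forall>\<^sub>F x in at_right s. x \<in> A i \<longleftrightarrow> s \<in> A i \<and> Sup (A i) \<noteq> s" if "i \<in> J" for i
    proof -
      obtain a b where ab: "A i = {a..b}"
        using connected_compact_interval_1 compact connected \<open>i \<in> J\<close> by metis
      consider "a > b" | "a \<le> b" "s < a" | "a \<le> s" "s < b" | "a \<le> b" "b \<le> s"
        by linarith
      then show ?thesis
      proof cases
        case 1
        then show ?thesis using ab by simp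
      next
        case 2
        have "\<forall>\<^sub>F x in at_right s. x < a"
          using 2 eventually_at_right_real[of s a] by (auto elim: eventually_mono)
        then show ?thesis by eventually_elim (use 2 ab in auto)
      next
        case 3
        have "\<forall>\<^sub>F x in at_right s. x \<in> {s<..<b}"
          using 3 eventually_at_right_real by blast
        then show ?thesis by eventually_elim (use 3 ab in auto)
      next
        case 4
        have "\<forall>\<^sub>F x in at_right s. x > s"
          by (rule eventually_at_right_less)
        then show ?thesis by eventually_elim (use 4 ab in auto)
      qed
    qed
    then have "\<forall>\<^sub>F x in at_right s. \<forall>i\<in>J. x \<in> A i \<longleftrightarrow> s \<in> A i \<and> Sup (A i) \<noteq> s"
      using \<open>finite J\<close> by (simp add: eventually_ball_finite)
    then obtain x where x: "\<forall>i\<in>J. x \<in> A i \<longleftrightarrow> s \<in> A i \<and> Sup (A i) \<noteq> s"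
      using eventually_happens trivial_limit_at_right_real by blast
    have Sup_mem: "Sup (A i) \<in> A i" if "i \<in> J" "A i \<noteq> {}" for i
      using that compact closed_contains_Sup compact_imp_bounded compact_imp_closed
        bounded_imp_bdd_above by metis
    have "{i \<in> J. s \<in> A i} = {i \<in> J. x \<in> A i} \<union> {i \<in> J. A i \<noteq> {} \<and> Sup (A i) = s}"
      using x Sup_mem by auto
    moreover have "{i \<in> J. x \<in> A i} \<inter> {i \<in> J. A i \<noteq> {} \<and> Sup (A i) = s} = {}"
      using x by auto
    ultimately have "sum \<alpha> {i \<in> J. s \<in> A i} =
        sum \<alpha> {i \<in> J. x \<in> A i} + sum \<alpha> {i \<in> J. A i \<noteq> {} \<and> Sup (A i) = s}"
      using \<open>finite J\<close> by (simp add: sum.union_disjoint)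
    then show ?thesis
      by (simp add: zero)
  qed
  let ?N = "{i \<in> J. A i \<noteq> {}}"
  have "sum \<alpha> ?N = (\<Sum>s\<in>(\<lambda>i. Sup (A i)) ` ?N. sum \<alpha> {i \<in> ?N. Sup (A i) = s})"
    by (rule sum.group[symmetric]) (use \<open>finite J\<close> in auto)
  also have "\<dots> = 0"
    using right_endpoints by (simp add: conj_assoc)
  finally show ?thesis .
qed

text \<open>Convexity with respect to the pointwise vector space structure on functions.\<close>

definition convex_funs :: "('a \<Rightarrow> real) set \<Rightarrow> bool" where
  "convex_funs K \<longleftrightarrow> (\<forall>w\<in>K. \<forall>w'\<in>K. \<forall>r\<in>{0..1}. (\<lambda>a. (1 - r) * w a + r * w' a) \<in> K)"

lemma convex_funs_coordinate:
  assumes "convex_funs K"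
  shows "connected ((\<lambda>w. w a) ` K)"
proof -
  have "convex ((\<lambda>w. w a) ` K)"
    unfolding convex_alt
  proof clarify
    fix w w' and r :: real
    assume "w \<in> K" "w' \<in> K" "0 \<le> r" "r \<le> 1"
    then have "(\<lambda>b. (1 - r) * w b + r * w' b) \<in> K"
      using assms by (simp add: convex_funs_def)
    then show "(1 - r) *\<^sub>R w a + r *\<^sub>R w' a \<in> (\<lambda>w. w a) ` K"
      by (intro image_eqI[where x = "\<lambda>b. (1 - r) * w b + r * w' b"]) simp_all
  qed
  then show ?thesis by (rule convex_connected)
qed

lemma compact_coordinate_image:
  fixes K :: "('a \<Rightarrow> real) set"
  assumes "compact K"
  shows "compact ((\<lambda>w. w a) ` K)"
  using assms continuous_on_product_coordinates[of a] continuous_on_subset subset_UNIV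
  by (metis compact_continuous_image)

lemma closed_coordinate_Collect:
  fixes T :: "real set"
  assumes "closed T"
  shows "closed {w :: 'a \<Rightarrow> real. w a \<in> T}"
  using closed_vimage[OF assms continuous_on_product_coordinates[of a]] by (simp add: vimage_def)

text \<open>Projecting away one coordinate at a time: over each point of the projection, the sets cut out
  compact intervals on the fibre, so the linear relation survives by
  \<open>euler_relation_compact_intervals\<close>.\<close>

lemma euler_relation_projection:
  fixes \<alpha> :: "'i \<Rightarrow> int" and K :: "'i \<Rightarrow> ('a \<Rightarrow> real) set"
  assumes "finite J" "finite I"
    and compact: "\<And>i. i \<in> J \<Longrightarrow> compact (K i)"
    and convex: "\<And>i. i \<in> J \<Longrightarrow> convex_funs (K i)"
    and zero: "\<And>w. sum \<alpha> {i \<in> J. w \<in> K i} = 0"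
  shows "sum \<alpha> {i \<in> J. \<exists>y\<in>K i. \<forall>a. a \<notin> I \<longrightarrow> y a = x a} = 0"
  using \<open>finite I\<close>
proof (induction I arbitrary: x)
  case empty
  have "(\<exists>y\<in>K i. \<forall>a. y a = x a) \<longleftrightarrow> x \<in> K i" for i
    by (metis ext)
  then show ?case using zero by simp
next
  case (insert b I)
  define F where "F i = K i \<inter> (\<Inter>a\<in>- insert b I. {y. y a \<in> {x a}})" for i
  have F: "F i = {y \<in> K i. \<forall>a. a \<notin> insert b I \<longrightarrow> y a = x a}" for i
    by (auto simp: F_def)
  have "sum \<alpha> {i \<in> J. (\<lambda>y. y b) ` F i \<noteq> {}} = 0"
  proof (rule euler_relation_compact_intervals[OF \<open>finite J\<close>])
    fix i assume i: "i \<in> J"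
    have "compact (F i)"
      unfolding F_def
      by (intro compact_Int_closed compact i closed_INT ballI closed_coordinate_Collect) simp
    then show "compact ((\<lambda>y. y b) ` F i)"
      by (rule compact_coordinate_image)
    have "convex_funs (F i)"
      using convex[OF i] by (auto simp: convex_funs_def F algebra_simps)
    then show "connected ((\<lambda>y. y b) ` F i)"
      by (rule convex_funs_coordinate)
  next
    fix s
    have "s \<in> (\<lambda>y. y b) ` F i \<longleftrightarrow> (\<exists>y\<in>K i. \<forall>a. a \<notin> I \<longrightarrow> y a = (x(b := s)) a)" for i
      using \<open>b \<notin> I\<close> by (auto simp: F image_iff)
    then show "sum \<alpha> {i \<in> J. s \<in> (\<lambda>y. y b) ` F i} = 0"
      using insert.IH[of "x(b := s)"] by simp
  qed
  moreover have "(\<lambda>y. y b) ` F i \<noteq> {} \<longleftrightarrow> (\<exists>y\<in>K i. \<forall>a. a \<notin> insert b I \<longrightarrow> y a = x a)" for i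
    by (auto simp: F)
  ultimately show ?case by simp
qed

text \<open>Projecting away all the coordinates in which the sets extend leaves a single point, which lies
  in the image of a set exactly if that set is nonempty.\<close>

lemma euler_relation:
  fixes \<alpha> :: "'i \<Rightarrow> int" and K :: "'i \<Rightarrow> ('a \<Rightarrow> real) set"
  assumes "finite J" "finite I"
    and "\<And>i. i \<in> J \<Longrightarrow> compact (K i)"
    and "\<And>i. i \<in> J \<Longrightarrow> convex_funs (K i)"
    and support: "\<And>i w a. i \<in> J \<Longrightarrow> w \<in> K i \<Longrightarrow> a \<notin> I \<Longrightarrow> w a = 0"
    and "\<And>w. sum \<alpha> {i \<in> J. w \<in> K i} = 0"
  shows "sum \<alpha> {i \<in> J. K i \<noteq> {}} = 0"
proof -
  have "sum \<alpha> {i \<in> J. \<exists>y\<in>K i. \<forall>a. a \<notin> I \<longrightarrow> y a = (\<lambda>_. 0) a} = 0"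
    by (rule euler_relation_projection) (use assms in auto)
  moreover have "{i \<in> J. \<exists>y\<in>K i. \<forall>a. a \<notin> I \<longrightarrow> y a = (\<lambda>_. 0) a} = {i \<in> J. K i \<noteq> {}}"
    using support by blast
  ultimately show ?thesis by simp
qed

section \<open>Vanishing finite differences\<close>

lemma sum_Pow_insert:
  fixes f :: "'a set \<Rightarrow> 'b::comm_monoid_add"
  assumes "finite V" "a \<notin> V"
  shows "sum f (Pow (insert a V)) = (\<Sum>S\<in>Pow V. f S + f (insert a S))"
proof -
  have "inj_on (insert a) (Pow V)"
    using assms(2) by (auto simp: inj_on_def)
  moreover have "Pow V \<inter> insert a ` Pow V = {}"
    using assms(2) by auto
  ultimately show ?thesis
    using assms(1) by (simp add: Pow_insert sum.union_disjoint sum.reindex sum.distrib)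
qed

lemma alternating_sum_Pow:
  assumes "finite V" "V \<noteq> {}"
  shows "(\<Sum>S\<in>Pow V. (- 1) ^ card S) = (0 :: int)"
proof -
  obtain a where "a \<in> V" using assms(2) by blast
  have "(\<Sum>S\<in>Pow (V - {a}). (- 1) ^ card S + (- 1) ^ card (insert a S)) = (0 :: int)"
  proof (intro sum.neutral ballI)
    fix S assume "S \<in> Pow (V - {a})"
    then have "finite S" "a \<notin> S"
      using assms(1) finite_subset by auto
    then show "(- 1) ^ card S + (- 1) ^ card (insert a S) = (0 :: int)" by simp
  qed
  then show ?thesis
    using sum_Pow_insert[of "V - {a}" a "\<lambda>S. (- 1) ^ card S :: int"] assms(1) \<open>a \<in> V\<close>
    by (simp add: insert_absorb)
qed

text \<open>The hypothesis says that the \<open>card V\<close>-th finite difference of \<open>g\<close> vanishes, with the binomial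
  coefficients expanded into subsets of \<open>V\<close>. The conclusion is Newton's forward difference
  formula.\<close>

lemma newton_expansion:
  fixes g :: "nat \<Rightarrow> rat"
  assumes "finite V"
    and "\<And>t. (\<Sum>S\<in>Pow V. (- 1) ^ card S * g (t + card (V - S))) = 0"
  shows "\<exists>a. \<forall>t. g t = (\<Sum>k<card V. of_nat (t choose k) * a k)"
  using assms
proof (induction V arbitrary: g)
  case empty
  then show ?case by simp
next
  case (insert v V)
  have "(\<Sum>S\<in>Pow V. (- 1) ^ card S * (g (Suc (t + card (V - S))) - g (t + card (V - S)))) = 0"
    for t
  proof -
    have "(\<Sum>S\<in>Pow V. (- 1) ^ card S * (g (Suc (t + card (V - S))) - g (t + card (V - S)))) =
        (\<Sum>S\<in>Pow V. (- 1) ^ card S * g (t + card (insert v V - S))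
          + (- 1) ^ card (insert v S) * g (t + card (insert v V - insert v S)))"
    proof (rule sum.cong)
      fix S assume "S \<in> Pow V"
      then have "finite S" "v \<notin> S" "insert v V - S = insert v (V - S)"
        "insert v V - insert v S = V - S"
        using insert.hyps finite_subset by auto
      then show "(- 1) ^ card S * (g (Suc (t + card (V - S))) - g (t + card (V - S))) =
          (- 1) ^ card S * g (t + card (insert v V - S))
          + (- 1) ^ card (insert v S) * g (t + card (insert v V - insert v S))"
        using insert.hyps by (simp add: algebra_simps)
    qed simp
    then show ?thesis
      using insert.prems[of t] by (simp only: sum_Pow_insert[OF insert.hyps])
  qed
  then obtain a where a: "\<And>t. g (Suc t) - g t = (\<Sum>k<card V. of_nat (t choose k) * a k)"
    using insert.IH[of "\<lambda>t. g (Suc t) - g t"] by auto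
  have "g t = (\<Sum>k<card V. of_nat (t choose Suc k) * a k) + g 0" for t
  proof (induction t)
    case (Suc t)
    then show ?case
      using a[of t] by (simp add: algebra_simps sum.distrib)
  qed simp
  moreover have "(\<Sum>k<card (insert v V).
        of_nat (t choose k) * (case k of 0 \<Rightarrow> g 0 | Suc k \<Rightarrow> a k)) =
      (\<Sum>k<card V. of_nat (t choose Suc k) * a k) + g 0" for t
    using insert.hyps by (simp add: sum.lessThan_Suc_shift del: sum.lessThan_Suc)
  ultimately have "\<forall>t. g t =
      (\<Sum>k<card (insert v V). of_nat (t choose k) * (case k of 0 \<Rightarrow> g 0 | Suc k \<Rightarrow> a k))"
    by metis
  then show ?case by blast
qed

definition choose_poly :: "nat \<Rightarrow> rat poly" where
  "choose_poly k = smult (1 / fact k) (\<Prod>i<k. [:- of_nat i, 1:])"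

lemma poly_choose_poly: "poly (choose_poly k) (of_nat t) = of_nat (t choose k)"
proof -
  have "poly (choose_poly k) (of_nat t) = (of_nat t gchoose k :: rat)"
    by (simp add: choose_poly_def poly_prod gbinomial_prod_rev atLeast0LessThan)
  then show ?thesis by (simp add: binomial_gbinomial)
qed

lemma polynomial_of_vanishing_difference:
  fixes g :: "nat \<Rightarrow> rat"
  assumes "finite V"
    and "\<And>t. (\<Sum>S\<in>Pow V. (- 1) ^ card S * g (t + card (V - S))) = 0"
  shows "\<exists>p. \<forall>t. poly p (of_nat t) = g t"
proof -
  obtain a where "\<And>t. g t = (\<Sum>k<card V. of_nat (t choose k) * a k)"
    using newton_expansion[OF assms] by blast
  then have "\<forall>t. poly (\<Sum>k<card V. smult (a k) (choose_poly k)) (of_nat t) = g t"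
    by (simp add: poly_sum poly_choose_poly mult.commute)
  then show ?thesis by blast
qed

section \<open>Representations by nonnegative weights\<close>

text \<open>Weights are functions on the whole type that vanish off \<open>V\<close>, so that \<open>V\<close> can be any finite
  set and yet only finitely many coordinates matter. \<open>V\<close> may be affinely dependent, so
  a point has many families of weights in general.\<close>

definition weights :: "'v set \<Rightarrow> real \<Rightarrow> 'v \<Rightarrow> ('v::euclidean_space \<Rightarrow> real) set" where
  "weights V t u = {w. (\<forall>v. v \<notin> V \<longrightarrow> w v = 0) \<and> (\<forall>v\<in>V. 0 \<le> w v) \<and>
     sum w V = t \<and> (\<Sum>v\<in>V. w v *\<^sub>R v) = u}"

lemma mem_dilated_hull_iff_weights:
  assumes "finite V" "V \<noteq> {}" "0 \<le> t"
  shows "u \<in> (\<lambda>x. t *\<^sub>R x) ` (convex hull V) \<longleftrightarrow> weights V t u \<noteq> {}"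
proof
  assume "u \<in> (\<lambda>x. t *\<^sub>R x) ` (convex hull V)"
  then obtain w where w: "\<forall>v\<in>V. 0 \<le> w v" "sum w V = 1" "u = t *\<^sub>R (\<Sum>v\<in>V. w v *\<^sub>R v)"
    using convex_hull_finite[OF assms(1)] by auto
  have "(\<lambda>v. if v \<in> V then t * w v else 0) \<in> weights V t u"
    using w assms(3) by (auto simp: weights_def scaleR_sum_right simp flip: sum_distrib_left)
  then show "weights V t u \<noteq> {}" by blast
next
  assume "weights V t u \<noteq> {}"
  then obtain w where w: "\<forall>v\<in>V. 0 \<le> w v" "sum w V = t" "(\<Sum>v\<in>V. w v *\<^sub>R v) = u"
    by (auto simp: weights_def)
  show "u \<in> (\<lambda>x. t *\<^sub>R x) ` (convex hull V)"
  proof (cases "t = 0")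
    case True
    \<comment> \<open>The dilate by 0 of the nonempty hull is \<open>{0}\<close>, and the only weights of total 0 are 0.\<close>
    then have "\<forall>v\<in>V. w v = 0"
      using w assms(1) by (simp add: sum_nonneg_eq_0_iff)
    then have "u = 0" using w(3) by auto
    moreover obtain x where "x \<in> convex hull V"
      using assms(2) by fastforce
    ultimately show ?thesis using True by auto
  next
    case False
    have "\<forall>v\<in>V. 0 \<le> w v / t" "(\<Sum>v\<in>V. w v / t) = 1"
      using w assms(3) False by (simp_all flip: sum_divide_distrib)
    then have "(\<Sum>v\<in>V. (w v / t) *\<^sub>R v) \<in> convex hull V"
      unfolding convex_hull_finite[OF assms(1)] by (intro CollectI exI[of _ "\<lambda>v. w v / t"]) simp
    moreover have "u = t *\<^sub>R (\<Sum>v\<in>V. (w v / t) *\<^sub>R v)"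
      using w(3) False by (simp add: scaleR_sum_right)
    ultimately show ?thesis by blast
  qed
qed

text \<open>Tychonoff's theorem for the product topology on functions.\<close>

lemma compact_box_funs: "compact {w :: 'a \<Rightarrow> real. \<forall>a. w a \<in> {lo a..hi a}}"
proof -
  have "compactin (product_topology (\<lambda>_. euclidean) UNIV) (\<Pi>\<^sub>E a\<in>UNIV. {lo a..hi a :: real})"
    by (simp add: compactin_PiE)
  moreover have "(\<Pi>\<^sub>E a\<in>UNIV. {lo a..hi a}) = {w. \<forall>a. w a \<in> {lo a..hi a}}"
    by (auto simp: PiE_def Pi_def)
  ultimately show ?thesis
    by (simp add: euclidean_product_topology)
qed

lemma compact_weights_ge:
  assumes "finite V"
  shows "compact {w \<in> weights V t u. \<forall>v\<in>S. 1 \<le> w v}"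
proof -
  let ?B = "{w. \<forall>v. w v \<in> {0..if v \<in> V then t else 0}}"
  have cont: "continuous_on UNIV (\<lambda>w :: 'a \<Rightarrow> real. sum w V)"
    "continuous_on UNIV (\<lambda>w. \<Sum>v\<in>V. w v *\<^sub>R v)"
    by (auto intro!: continuous_intros)
  have "{w \<in> weights V t u. \<forall>v\<in>S. 1 \<le> w v} =
      ?B \<inter> ((\<lambda>w. sum w V) -` {t} \<inter> (\<lambda>w. \<Sum>v\<in>V. w v *\<^sub>R v) -` {u} \<inter> (\<Inter>v\<in>S. {w. w v \<in> {1..}}))"
    (is "?L = ?R")
  proof
    have "w v \<le> sum w V" if "\<forall>v\<in>V. 0 \<le> w v" "v \<in> V" for w :: "'a \<Rightarrow> real" and v
      using that assms by (intro member_le_sum) auto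
    then show "?L \<subseteq> ?R" by (auto simp: weights_def)
    show "?R \<subseteq> ?L"
      by (force simp: weights_def split: if_splits)
  qed
  moreover have "compact ?R"
    by (intro compact_Int_closed compact_box_funs closed_Int closed_vimage cont closed_INT ballI
        closed_coordinate_Collect) simp_all
  ultimately show ?thesis by simp
qed

lemma convex_weights_ge: "convex_funs {w \<in> weights V t u. \<forall>v\<in>S. 1 \<le> w v}"
proof -
  have ge: "1 \<le> (1 - r) * x + r * y" if "1 \<le> x" "1 \<le> y" "0 \<le> r" "r \<le> 1" for x y r :: real
    using that convex_bound_le[of "- x" "- 1" "- y" "1 - r" r] by simp
  show ?thesis
    unfolding convex_funs_def weights_def
    by (auto simp: sum.distrib scaleR_add_left ge simp flip: sum_distrib_left scaleR_scaleR
        scaleR_sum_right) (simp_all add: algebra_simps)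
qed

text \<open>Subtracting the indicator function of \<open>S\<close> from the weights.\<close>

lemma weights_ge_nonempty_iff:
  assumes "finite V" "S \<subseteq> V"
  shows "{w \<in> weights V t u. \<forall>v\<in>S. 1 \<le> w v} \<noteq> {} \<longleftrightarrow> weights V (t - card S) (u - \<Sum>S) \<noteq> {}"
proof -
  have 1: "(\<Sum>v\<in>V. of_bool (v \<in> S)) = real (card S)"
    using assms by (simp add: Int_absorb1)
  have 2: "(\<Sum>v\<in>V. of_bool (v \<in> S) *\<^sub>R v) = \<Sum>S"
    using assms by (simp add: of_bool_def if_distrib[of "\<lambda>r. r *\<^sub>R _"] sum.If_cases Int_absorb1 cong: if_cong)
  show ?thesis
  proof
    assume "{w \<in> weights V t u. \<forall>v\<in>S. 1 \<le> w v} \<noteq> {}"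
    then obtain w where "w \<in> weights V t u" "\<forall>v\<in>S. 1 \<le> w v" by blast
    then have "(\<lambda>v. w v - of_bool (v \<in> S)) \<in> weights V (t - card S) (u - \<Sum>S)"
      using assms(2) 1 2 by (auto simp: weights_def sum_subtractf scaleR_diff_left)
    then show "weights V (t - card S) (u - \<Sum>S) \<noteq> {}" by blast
  next
    assume "weights V (t - card S) (u - \<Sum>S) \<noteq> {}"
    then obtain w where "w \<in> weights V (t - card S) (u - \<Sum>S)" by blast
    then have "(\<lambda>v. w v + of_bool (v \<in> S)) \<in> {w \<in> weights V t u. \<forall>v\<in>S. 1 \<le> w v}"
      using assms(2) 1 2 by (auto simp: weights_def sum.distrib scaleR_add_left)
    then show "{w \<in> weights V t u. \<forall>v\<in>S. 1 \<le> w v} \<noteq> {}" by blast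
  qed
qed

text \<open>If nonnegative weights on \<open>V\<close> add up to at least \<open>card V\<close>, one of them is at least 1. So the
  sets of weights that are at least 1 at a given vertex cover all weights, and the alternating sum
  of the indicator functions of their intersections, the empty intersection included, is 0. All
  these intersections are compact and convex, so each indicator function can be replaced by the
  truth value of nonemptiness.\<close>

lemma alternating_sum_shifted_dilates:
  fixes V :: "'v::euclidean_space set"
  assumes "finite V" "V \<noteq> {}" "card V \<le> t"
  shows "(\<Sum>S | S \<in> Pow V \<and> u - \<Sum>S \<in> (\<lambda>x. (t - real (card S)) *\<^sub>R x) ` (convex hull V).
      (- 1) ^ card S) = (0 :: int)"
proof -
  define K where "K S = {w \<in> weights V t u. \<forall>v\<in>S. 1 \<le> w v}" for S
  have "(\<Sum>S | S \<in> Pow V \<and> K S \<noteq> {}. (- 1) ^ card S) = (0 :: int)"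
  proof (rule euler_relation[where I = V])
    show "(\<Sum>S | S \<in> Pow V \<and> w \<in> K S. (- 1) ^ card S) = (0 :: int)" for w
    proof (cases "w \<in> weights V t u")
      case True
      let ?T = "{v \<in> V. 1 \<le> w v}"
      have "?T \<noteq> {}"
      proof
        assume "?T = {}"
        then have "sum w V < (\<Sum>v\<in>V. 1)"
          using assms by (intro sum_strict_mono) auto
        then show False
          using True assms(3) by (simp add: weights_def)
      qed
      moreover have "{S \<in> Pow V. w \<in> K S} = Pow ?T"
        using True by (auto simp: K_def)
      ultimately show ?thesis
        using alternating_sum_Pow[of ?T] assms(1) by simp
    next
      case False
      then show ?thesis by (simp add: K_def)
    qed
    show "compact (K S)" "convex_funs (K S)" for S
      using assms(1) by (simp_all add: K_def compact_weights_ge convex_weights_ge)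
    show "w v = 0" if "w \<in> K S" "v \<notin> V" for S w v
      using that by (simp add: K_def weights_def)
  qed (use assms(1) in auto)
  moreover have "K S \<noteq> {} \<longleftrightarrow> u - \<Sum>S \<in> (\<lambda>x. (t - real (card S)) *\<^sub>R x) ` (convex hull V)"
    if "S \<in> Pow V" for S
  proof -
    have "real (card S) \<le> t"
      using that assms card_mono[of V S] by simp
    then show ?thesis
      using that weights_ge_nonempty_iff[OF assms(1), of S t u]
        mem_dilated_hull_iff_weights[OF assms(1,2), of "t - real (card S)" "u - \<Sum>S"]
      unfolding K_def by simp
  qed
  then have "{S \<in> Pow V. K S \<noteq> {}} =
      {S \<in> Pow V. u - \<Sum>S \<in> (\<lambda>x. (t - real (card S)) *\<^sub>R x) ` (convex hull V)}"
    by blast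
  ultimately show ?thesis by simp
qed

section \<open>Polynomiality of the translated enumerator\<close>

lemma int_vectors_add_iff:
  assumes "z \<in> int_vectors"
  shows "x + z \<in> int_vectors \<longleftrightarrow> x \<in> int_vectors"
proof -
  have "x $ i + z $ i \<in> \<int> \<longleftrightarrow> x $ i \<in> \<int>" for i
    using assms Ints_diff[of "x $ i + z $ i" "z $ i"] by (auto simp: int_vectors_def)
  then show ?thesis by (simp add: int_vectors_def)
qed

lemma int_vectors_sum: "S \<subseteq> int_vectors \<Longrightarrow> \<Sum>S \<in> int_vectors"
  by (auto simp: int_vectors_def intro!: Ints_sum)

lemma int_vectors_scale: "x \<in> int_vectors \<Longrightarrow> r \<in> \<int> \<Longrightarrow> r *\<^sub>R x \<in> int_vectors"
  by (simp add: int_vectors_def)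

lemma finite_bounded_Int_int_vectors:
  fixes B :: "(real ^ 'n) set"
  assumes "bounded B"
  shows "finite (B \<inter> int_vectors)"
proof -
  obtain b where b: "\<And>x. x \<in> B \<Longrightarrow> norm x \<le> b"
    using assms by (auto simp: bounded_iff)
  have "vec_nth ` (B \<inter> int_vectors) \<subseteq> (\<Pi>\<^sub>E i\<in>UNIV. {k \<in> \<int>. \<bar>k\<bar> \<le> b})"
    using b component_le_norm_cart order_trans by (fastforce simp: int_vectors_def)
  then have "finite (vec_nth ` (B \<inter> int_vectors))"
    by (rule finite_subset) (simp add: finite_PiE finite_abs_int_segment)
  then show ?thesis
    by (rule finite_imageD) (simp add: inj_on_def vec_nth_inject)
qed

lemma translated_enumerator_alt:
  "translated_enumerator P c t = card {a \<in> int_vectors. a - c \<in> (\<lambda>x. real t *\<^sub>R x) ` P}"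
proof -
  have "(\<lambda>x. c + x) ` ((\<lambda>x. real t *\<^sub>R x) ` P) \<inter> int_vectors =
      {a \<in> int_vectors. a - c \<in> (\<lambda>x. real t *\<^sub>R x) ` P}"
    by (auto simp: image_iff algebra_simps)
  then show ?thesis by (simp add: translated_enumerator_def)
qed

lemma finite_translated_lattice_points:
  fixes P :: "(real ^ 'n) set"
  assumes "bounded P"
  shows "finite {a \<in> int_vectors. a - c \<in> (\<lambda>x. r *\<^sub>R x) ` P}"
proof -
  have "bounded ((\<lambda>x. c + x) ` ((\<lambda>x. r *\<^sub>R x) ` P))"
    using assms by (intro bounded_translation bounded_scaling)
  from finite_bounded_Int_int_vectors[OF this] show ?thesis
    by (rule rev_finite_subset) (auto simp: image_iff algebra_simps)
qed

lemma translated_enumerator_add_int: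
  assumes "z \<in> int_vectors"
  shows "translated_enumerator P (c + z) t = translated_enumerator P c t"
  unfolding translated_enumerator_alt
proof (rule bij_betw_same_card)
  let ?A = "\<lambda>c. {a \<in> int_vectors. a - c \<in> (\<lambda>x. real t *\<^sub>R x) ` P}"
  have shift: "a + z \<in> ?A (c + z) \<longleftrightarrow> a \<in> ?A c" for a
    by (simp add: int_vectors_add_iff[OF assms])
  have "a - z \<in> ?A c" if "a \<in> ?A (c + z)" for a
    using shift[of "a - z"] that unfolding diff_add_cancel by (rule iffD1)
  then show "bij_betw (\<lambda>a. a - z) (?A (c + z)) (?A c)"
    using shift by (intro bij_betwI[where g = "\<lambda>a. a + z"] funcsetI) (blast, blast, simp_all)
qed

text \<open>Shifting by the lattice vector \<open>\<Sum>S\<close> lets all the terms count points of one finite set \<open>A\<close>.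
  Exchanging the sums then leaves, for each point of \<open>A\<close>, an alternating sum over the subsets of
  \<open>V\<close> that vanishes by \<open>alternating_sum_shifted_dilates\<close>.\<close>

lemma alternating_sum_translated_enumerator:
  fixes V :: "(real ^ 'n) set"
  assumes "finite V" "V \<noteq> {}" "V \<subseteq> int_vectors"
  shows "(\<Sum>S\<in>Pow V. (- 1) ^ card S *
      int (translated_enumerator (convex hull V) c (t + card (V - S)))) = 0"
proof -
  let ?P = "convex hull V" and ?N = "t + card V"
  let ?R = "\<lambda>S a. a - c - \<Sum>S \<in> (\<lambda>x. (real ?N - real (card S)) *\<^sub>R x) ` ?P"
  define A where "A = (\<Union>S\<in>Pow V. {a \<in> int_vectors. ?R S a})"
  have "bounded ?P"
    using assms(1) by (simp add: finite_imp_bounded bounded_convex_hull)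
  then have "finite {a \<in> int_vectors. ?R S a}" for S
    using finite_translated_lattice_points[of ?P "c + \<Sum>S"] by (simp add: diff_diff_eq)
  then have "finite A"
    using assms(1) by (simp add: A_def)
  have count: "translated_enumerator ?P c (t + card (V - S)) = card {a \<in> A. ?R S a}" if "S \<in> Pow V" for S
  proof -
    have "card S \<le> card V" "finite S"
      using that assms(1) card_mono finite_subset by auto
    then have N: "real (t + card (V - S)) = real ?N - real (card S)"
      using that by (simp add: card_Diff_subset)
    have "\<Sum>S \<in> int_vectors"
      using that assms(3) by (intro int_vectors_sum) auto
    then have "translated_enumerator ?P c (t + card (V - S)) =
        translated_enumerator ?P (c + \<Sum>S) (t + card (V - S))"
      by (rule translated_enumerator_add_int[symmetric])
    also have "\<dots> = card {a \<in> int_vectors. ?R S a}"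
      unfolding translated_enumerator_alt N diff_diff_eq ..
    also have "{a \<in> int_vectors. ?R S a} = {a \<in> A. ?R S a}"
      using that by (auto simp: A_def)
    finally show ?thesis .
  qed
  have "(\<Sum>S\<in>Pow V. (- 1) ^ card S * int (translated_enumerator ?P c (t + card (V - S)))) =
      (\<Sum>S\<in>Pow V. \<Sum>a | a \<in> A \<and> ?R S a. (- 1) ^ card S)"
    using count by (intro sum.cong) (simp_all add: mult.commute)
  also have "\<dots> = (\<Sum>a\<in>A. \<Sum>S | S \<in> Pow V \<and> ?R S a. (- 1) ^ card S)"
    using assms(1) \<open>finite A\<close> by (intro sum.swap_restrict) auto
  also have "\<dots> = 0"
    by (intro sum.neutral ballI alternating_sum_shifted_dilates assms) simp
  finally show ?thesis .
qed

lemma lattice_polytope_hull: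
  assumes "lattice_polytope P"
  obtains V where "finite V" "V \<noteq> {}" "V \<subseteq> int_vectors" "P = convex hull V"
proof
  let ?V = "{v. v extreme_point_of P}"
  show "P = convex hull ?V"
    using assms by (intro Krein_Milman_Minkowski)
      (auto simp: lattice_polytope_def polytope_imp_compact polytope_imp_convex)
  then show "?V \<noteq> {}"
    using assms by (auto simp: lattice_polytope_def)
  show "finite ?V"
    using assms by (simp add: lattice_polytope_def finite_polyhedron_extreme_points
        polytope_imp_polyhedron)
  show "?V \<subseteq> int_vectors"
    using assms by (auto simp: lattice_polytope_def)
qed

text \<open>Ehrhart's theorem for translated dilates. The polynomial is also correct at \<open>t = 0\<close>, where
  the enumerator counts the lattice points of \<open>{c}\<close>: the difference equation is valid from
  there on.\<close>

lemma translated_enumerator_polynomial: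
  assumes "lattice_polytope P"
  shows "\<exists>p. \<forall>t. poly p (of_nat t) = (of_nat (translated_enumerator P c t) :: rat)"
proof -
  obtain V where V: "finite V" "V \<noteq> {}" "V \<subseteq> int_vectors" "P = convex hull V"
    using lattice_polytope_hull[OF assms] .
  show ?thesis
  proof (rule polynomial_of_vanishing_difference[OF V(1)])
    fix t
    have "(0 :: rat) = of_int (\<Sum>S\<in>Pow V. (- 1) ^ card S *
        int (translated_enumerator P c (t + card (V - S))))"
      using alternating_sum_translated_enumerator[OF V(1-3), of c t] V(4) by simp
    then show "(\<Sum>S\<in>Pow V. (- 1) ^ card S *
        (of_nat (translated_enumerator P c (t + card (V - S))) :: rat)) = 0"
      by simp
  qed
qed

section \<open>Constituents\<close>

lemma ehrhart_translate:
  "ehrhart ((\<lambda>x. c + x) ` P) t = translated_enumerator P (real t *\<^sub>R c) t"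
  by (simp add: ehrhart_def translated_enumerator_def image_image scaleR_add_right)

lemma denominator_pos: "denominator x > 0"
  by (simp add: denominator_def quotient_of_denom_pos')

lemma denominator_times_Ints:
  assumes "x \<in> \<rat>"
  shows "real (denominator x) * x \<in> \<int>"
proof -
  obtain q where q: "x = real_of_rat q"
    using assms by (auto elim: Rats_cases)
  have "inj real_of_rat" by (simp add: inj_def)
  then have inv: "inv real_of_rat x = q"
    by (simp add: q)
  obtain a b where ab: "quotient_of q = (a, b)" by fastforce
  then have "b > 0" "q = of_int a / of_int b"
    using quotient_of_denom_pos quotient_of_div by auto
  then have "real (denominator x) * x = of_int a"
    using ab inv by (simp add: denominator_def q of_rat_divide)
  then show ?thesis by simp
qed

lemma den_pos: "den c > 0"
proof -
  have "0 \<notin> range (\<lambda>i. denominator (c $ i))"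
    using denominator_pos by (metis imageE less_irrefl)
  then show ?thesis
    by (simp add: den_def Lcm_0_iff flip: neq0_conv)
qed

lemma den_times_int_vectors:
  assumes "c \<in> rat_vectors"
  shows "real (den c) *\<^sub>R c \<in> int_vectors"
proof -
  have "real (den c) * c $ i \<in> \<int>" for i
  proof -
    have "denominator (c $ i) dvd den c"
      by (simp add: den_def dvd_Lcm)
    then obtain m where "den c = denominator (c $ i) * m" ..
    then have "real (den c) * c $ i = real m * (real (denominator (c $ i)) * c $ i)"
      by simp
    also have "\<dots> \<in> \<int>"
      using assms unfolding rat_vectors_def
      by (intro Ints_mult[OF Ints_of_nat denominator_times_Ints]) blast
    finally show ?thesis .
  qed
  then show ?thesis by (simp add: int_vectors_def)
qed

text \<open>The translation vectors \<open>mc\<close> and \<open>kc\<close> differ by an integer multiple of the lattice vector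
  \<open>(den c) c\<close>.\<close>

lemma translated_enumerator_cong:
  assumes "c \<in> rat_vectors" "[m = k] (mod den c)"
  shows "translated_enumerator P (real m *\<^sub>R c) t = translated_enumerator P (real k *\<^sub>R c) t"
proof -
  have "[int m = int k] (mod int (den c))"
    using assms(2) by (simp add: cong_int_iff)
  then obtain j where "int m = int k + int (den c) * j"
    using cong_sym cong_iff_lin by blast
  then have "real m = real k + of_int j * real (den c)"
    by (metis of_int_add of_int_mult of_int_of_nat_eq mult.commute)
  then have "real m *\<^sub>R c = real k *\<^sub>R c + of_int j *\<^sub>R (real (den c) *\<^sub>R c)"
    by (simp add: scaleR_add_left)
  moreover have "of_int j *\<^sub>R (real (den c) *\<^sub>R c) \<in> int_vectors"
    by (rule int_vectors_scale[OF den_times_int_vectors[OF assms(1)] Ints_of_int])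
  ultimately show ?thesis
    using translated_enumerator_add_int by metis
qed

lemma poly_eqI_infinite:
  fixes p q :: "'a::idom poly"
  assumes "infinite {x. poly p x = poly q x}"
  shows "p = q"
proof (rule ccontr)
  assume "p \<noteq> q"
  then have "finite {x. poly (p - q) x = 0}"
    by (intro poly_roots_finite) simp
  then show False using assms by simp
qed

theorem corollary3p4:
  fixes P :: "(real ^ 'n) set" and c :: "real ^ 'n"
  assumes "lattice_polytope P" and "c \<in> rat_vectors"
  shows "(\<exists>f. has_constituents (ehrhart ((\<lambda>x. c + x) ` P)) (den c) f) \<and>
    (\<forall>\<rho> f. has_constituents (ehrhart ((\<lambda>x. c + x) ` P)) \<rho> f \<longrightarrow>
      (\<forall>k\<in>{0..\<rho>}. \<forall>t>0.
        poly (f k) (of_nat t) = of_nat (translated_enumerator P (real k *\<^sub>R c) t)))"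
proof -
  obtain p where p: "\<And>k t. poly (p k) (of_nat t) =
      (of_nat (translated_enumerator P (real k *\<^sub>R c) t) :: rat)"
    using choice[of "\<lambda>k p. \<forall>t. poly p (of_nat t) =
        (of_nat (translated_enumerator P (real k *\<^sub>R c) t) :: rat)"]
      translated_enumerator_polynomial[OF assms(1)] by blast
  let ?L = "ehrhart ((\<lambda>x. c + x) ` P)"
  have L: "of_nat (?L t) = poly (p k) (of_nat t)" if "[t = k] (mod den c)" for t k
    unfolding p ehrhart_translate translated_enumerator_cong[OF assms(2) that] ..
  have "has_constituents ?L (den c) (p(0 := p (den c)))"
    unfolding has_constituents_def
  proof (intro conjI ballI allI impI)
    fix k t assume "k \<in> {1..den c}" "[t = k] (mod den c)"
    then show "poly ((p(0 := p (den c))) k) (of_nat t) = of_nat (?L t)"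
      using L[of t k] by simp
  qed (simp_all add: den_pos)
  moreover have "poly (f k) (of_nat t) = of_nat (translated_enumerator P (real k *\<^sub>R c) t)"
    if f: "has_constituents ?L \<rho> f" and k: "k \<in> {0..\<rho>}" for \<rho> f k t
  proof -
    have "\<rho> > 0" "f 0 = f \<rho>"
      using f by (auto simp: has_constituents_def)
    \<comment> \<open>The two polynomials agree on the common refinement of the residue classes modulo
      \<open>\<rho>\<close> and \<open>den c\<close>.\<close>
    have "poly (f k) (of_nat s) = poly (p k) (of_nat s)"
      if s_mem: "s \<in> range (\<lambda>j. k + \<rho> * den c * Suc j)" for s
    proof -
      obtain j where s: "s = k + \<rho> * den c * Suc j"
        using s_mem by blast
      have "s > 0"
        using \<open>\<rho> > 0\<close> den_pos[of c] by (simp add: s)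
      have "s = k + den c * (\<rho> * Suc j)"
        by (simp add: s algebra_simps)
      then have "[s = k] (mod den c)"
        by (simp only: cong_def mod_mult_self2)
      \<comment> \<open>The hypothesis on \<open>f\<close> speaks of the indices 1 to \<open>\<rho>\<close>; the index 0 stands for
        \<open>\<rho>\<close>.\<close>
      let ?k = "if k = 0 then \<rho> else k"
      have "[s = ?k] (mod \<rho>)" "?k \<in> {1..\<rho>}"
        using k \<open>\<rho> > 0\<close> by (simp_all add: s cong_def mult.assoc del: mult_Suc_right)
      then have "poly (f ?k) (of_nat s) = of_nat (?L s)"
        using f \<open>s > 0\<close> unfolding has_constituents_def by blast
      then show ?thesis
        using \<open>f 0 = f \<rho>\<close> L[OF \<open>[s = k] (mod den c)\<close>] by (cases "k = 0") simp_all
    qed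
    then have "of_nat ` range (\<lambda>j. k + \<rho> * den c * Suc j) \<subseteq> {x. poly (f k) x = poly (p k) x}"
      by blast
    moreover have "infinite (of_nat ` range (\<lambda>j. k + \<rho> * den c * Suc j) :: rat set)"
    proof -
      have "inj (\<lambda>j. k + \<rho> * den c * Suc j)"
        using \<open>\<rho> > 0\<close> den_pos[of c] by (auto simp: inj_def)
      then show ?thesis
        unfolding image_comp by (intro range_inj_infinite inj_compose inj_of_nat)
    qed
    ultimately have "f k = p k"
      by (rule poly_eqI_infinite[OF infinite_super])
    then show ?thesis using p by simp
  qed
  ultimately show ?thesis by blast
qed

end
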